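(* Let $p$ be a prime number. Let $N \in \mathbb{N}$ and let $\vec{\ell} = (\ell_i)_{i=0}^{N-1}$ be a sequence of $p$-adic optimisations such that $\dim(\ell_i)$ is independent of $i$; put $n := \dim(\vec{\ell})$. Let $(B_d)_{d=0}^{n-1}$ be a sequence of non-empty subsets of $\{0,1,\dots,p-1\}$, let $M \in \mathbb{N}$, and set $C := \prod_{d=0}^{n-1} B_d \subset \{0,\dots,p-1\}^n$. Suppose that $\sup_{\vec{c} \in C} \Sigma(\vec{\ell})(\vec{c}) < M$ and that $\vec{\ell}$ is concentrated on $C$. Let $w \colon \mathbb{Q}_p \to \mathbb{R}_{\geq 0}$ be either the map $x \mapsto |x|$, or the map sending $x$ to $0$ if $x \in p\mathbb{Z}_p$ and to $1$ if $x \notin p\mathbb{Z}_p$. Let $\ell$ be the $p$-adic optimisation $$\ell \colon \mathbb{Q}_p^n \to \mathbb{R}_{\geq 0} \sqcup \{\infty\}, \qquad \vec{c} = (c_d)_{d=0}^{n-1} \mapsto \Sigma(\vec{\ell})(\vec{c}) + M \sum_{d=0}^{n-1} \sum_{b \in B_d} w(c_d - b).$$ Then $\ell$ is $(1,C)$-reducible, and an element $\vec{c} \in C$ is an optimal solution of $\mathrm{OP}(\ell)$ if and only if it is an optimal solution of $\mathrm{OP}(\Sigma(\vec{\ell}),C)$.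
   Context: $\mathbb{N}$ is the set of non-negative integers. $|\cdot|$ is a fixed $p$-adic absolute value on $\mathbb{Q}_p$ (any normalisation $0<|p|<1$). For $\vec{x} \in \mathbb{Z}_p^n$, $\vec{x} \bmod p \in \{0,\dots,p-1\}^n$ is the entrywise reduction, i.e. the unique element of $\{0,\dots,p-1\}^n$ congruent to $\vec{x}$ modulo $p$. A $p$-adic optimisation is a map $\ell \colon \mathbb{Q}_p^n \to \mathbb{R}_{\geq 0} \sqcup \{\infty\}$ with $n \in \mathbb{N}$; $\dim(\ell) := n$. For $C \subset \mathbb{Q}_p^n$, $\mathrm{OP}(\ell,C)$ is the problem of minimising $\ell(\vec{c})$ subject to $\vec{c} \in C$ (an optimal solution is a minimiser of $\ell|_C$), and $\mathrm{OP}(\ell) := \mathrm{OP}(\ell,\mathbb{Q}_p^n)$. For $C \subset \{0,\dots,p-1\}^n$, a $p$-adic optimisation $\ell$ with $\dim(\ell) = n$ is called $(1,C)$-reducible if: (1) every optimal solution of $\mathrm{OP}(\ell,C)$ is an optimal solution of $\mathrm{OP}(\ell)$; and (2) every optimal solution $\vec{c} \in \mathbb{Q}_p^n$ of $\mathrm{OP}(\ell)$ belongs to $C + p\mathbb{Z}_p^n$, and $\vec{c} \bmod p$ is an optimal solution of $\mathrm{OP}(\ell,C)$. For a sequence $\vec{\ell} = (\ell_i)_{i=0}^{N-1}$ of $p$-adic optimisations with common dimension, $\dim(\vec{\ell})$ is $\dim(\ell_0)$ if $N>0$ and $0$ if $N=0$, and $\Sigma(\vec{\ell}) \colon \mathbb{Q}_p^{\dim(\vec{\ell})}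 \to \mathbb{R}_{\geq 0} \sqcup \{\infty\}$ is $\vec{c} \mapsto \sum_{i=0}^{N-1} \ell_i(\vec{c})$. For $C \subset \{0,\dots,p-1\}^{n}$ with $n = \dim(\vec{\ell})$, $\vec{\ell}$ is concentrated on $C$ if for every $i \in \{0,\dots,N-1\}$ and every $\vec{c} \in C + p\mathbb{Z}_p^n$ the following three conditions are equivalent: (1) $\ell_i(\vec{c}) \geq 1$; (2) $\ell_i(\vec{c} \bmod p) = 1$; (3) $\ell_i(\vec{c} \bmod p) > 0$. *)

theory Defs
  imports
    "HOL-Computational_Algebra.Primes"
    "HOL-Library.Extended_Nonnegative_Real"
    "HOL-Algebra.QuotRing"
begin

section \<open>The field of p-adic numbers\<close>

text \<open>The field is constructed as the completion of the rationals: Cauchy sequences modulo null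
  sequences. The prime is an ordinary (natural number) parameter.\<close>

subsection \<open>The p-adic absolute values on the rationals\<close>

definition rat_val :: "nat \<Rightarrow> rat \<Rightarrow> int" where
  "rat_val p x = int (multiplicity (int p) (fst (quotient_of x)))
               - int (multiplicity (int p) (snd (quotient_of x)))"

text \<open>The parameter \<open>r\<close> is the normalisation, i.e. the absolute value of \<open>p\<close>.\<close>

definition rat_abs :: "nat \<Rightarrow> real \<Rightarrow> rat \<Rightarrow> real" where
  "rat_abs p r x = (if x = 0 then 0 else r powi rat_val p x)"

lemma rat_val_frac:
  assumes "prime p" "a \<noteq> 0" "b \<noteq> 0"
  shows "rat_val p (of_int a / of_int b) =
    int (multiplicity (int p) a) - int (multiplicity (int p) b)"
proof -
  obtain c d where cd: "quotient_of (of_int a / of_int b) = (c, d)" by force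
  have d: "d > 0" using quotient_of_denom_pos[OF cd] .
  have eq: "(of_int a / of_int b :: rat) = of_int c / of_int d"
    using quotient_of_div[OF cd] .
  then have "(of_int (a * d) :: rat) = of_int (c * b)"
    using d assms by (simp add: field_simps)
  then have ad: "a * d = c * b" by linarith
  then have c: "c \<noteq> 0" using assms d by auto
  have p: "prime_elem (int p)" using assms by auto
  have "multiplicity (int p) (a * d) = multiplicity (int p) (c * b)" by (simp only: ad)
  then have "multiplicity (int p) a + multiplicity (int p) d
      = multiplicity (int p) c + multiplicity (int p) b"
    using prime_elem_multiplicity_mult_distrib[OF p] assms c d by simp
  then show ?thesis by (simp add: rat_val_def cd)
qed

lemma rat_frac_cases:
  obtains a b :: int where "x = (of_int a / of_int b :: rat)" "b \<noteq> 0"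
proof -
  obtain c d where cd: "quotient_of x = (c, d)" by force
  then show ?thesis using quotient_of_div[OF cd] quotient_of_denom_pos[OF cd] that[of c d] by simp
qed

lemma rat_val_mult:
  assumes "prime p" "x \<noteq> 0" "y \<noteq> 0"
  shows "rat_val p (x * y) = rat_val p x + rat_val p y"
proof -
  obtain a b where x: "x = of_int a / of_int b" and b: "b \<noteq> 0" by (rule rat_frac_cases)
  obtain c d where y: "y = of_int c / of_int d" and d: "d \<noteq> 0" by (rule rat_frac_cases)
  have ac: "a \<noteq> 0" "c \<noteq> 0" using assms x y by auto
  have p: "prime_elem (int p)" using assms by auto
  have "x * y = of_int (a * c) / of_int (b * d)" by (simp add: x y)
  then have "rat_val p (x * y) =
      int (multiplicity (int p) (a * c)) - int (multiplicity (int p) (b * d))"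
    using rat_val_frac[OF assms(1), of "a * c" "b * d"] ac b d by simp
  then show ?thesis
    using ac b d rat_val_frac[OF assms(1)] prime_elem_multiplicity_mult_distrib[OF p]
    by (simp add: x y)
qed

lemma rat_val_add:
  assumes "prime p" "x \<noteq> 0" "y \<noteq> 0" "x + y \<noteq> 0"
  shows "rat_val p (x + y) \<ge> min (rat_val p x) (rat_val p y)"
proof -
  obtain a b where x: "x = of_int a / of_int b" and b: "b \<noteq> 0" by (rule rat_frac_cases)
  obtain c d where y: "y = of_int c / of_int d" and d: "d \<noteq> 0" by (rule rat_frac_cases)
  have ac: "a \<noteq> 0" "c \<noteq> 0" using assms x y by auto
  have p: "prime_elem (int p)" using assms by auto
  have nu: "\<not> is_unit (int p)" using assms(1) not_prime_unit by auto
  have s: "x + y = of_int (a * d + c * b) / of_int (b * d)"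
    using b d by (simp add: x y field_simps)
  have n0: "a * d + c * b \<noteq> 0"
    using s assms(4) by (metis div_0 of_int_0)
  let ?k = "min (multiplicity (int p) (a * d)) (multiplicity (int p) (c * b))"
  have "int p ^ ?k dvd a * d" "int p ^ ?k dvd c * b"
    by (auto intro: multiplicity_dvd')
  then have "int p ^ ?k dvd a * d + c * b" by simp
  then have "?k \<le> multiplicity (int p) (a * d + c * b)"
    using n0 nu by (intro multiplicity_geI) auto
  moreover have "rat_val p (x + y) = int (multiplicity (int p) (a * d + c * b))
      - int (multiplicity (int p) (b * d))"
    unfolding s using n0 b d by (intro rat_val_frac[OF assms(1)]) auto
  ultimately show ?thesis
    using ac b d rat_val_frac[OF assms(1)] prime_elem_multiplicity_mult_distrib[OF p]
    by (simp add: x y min_def split: if_splits)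
qed

lemma multiplicity_uminus: "multiplicity q (- a) = multiplicity q (a :: int)"
  by (simp add: multiplicity_def)

lemma rat_val_minus: "rat_val p (- x) = rat_val p x"
  by (cases "quotient_of x")
    (simp add: rat_val_def rat_uminus_code multiplicity_uminus)

lemma rat_abs_zero [simp]: "rat_abs p r 0 = 0"
  by (simp add: rat_abs_def)

lemma rat_abs_one [simp]: "rat_abs p r 1 = 1"
  by (simp add: rat_abs_def rat_val_def)

lemma rat_abs_nonneg: "0 < r \<Longrightarrow> 0 \<le> rat_abs p r x"
  by (simp add: rat_abs_def)

lemma rat_abs_minus [simp]: "rat_abs p r (- x) = rat_abs p r x"
  by (simp add: rat_abs_def rat_val_minus)

lemma rat_abs_diff_commute: "rat_abs p r (x - y) = rat_abs p r (y - x)"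
  by (metis minus_diff_eq rat_abs_minus)

lemma rat_abs_mult:
  assumes "prime p" "0 < r"
  shows "rat_abs p r (x * y) = rat_abs p r x * rat_abs p r y"
  using assms by (auto simp: rat_abs_def rat_val_mult power_int_add)

lemma rat_abs_add:
  assumes "prime p" "0 < r" "r < 1"
  shows "rat_abs p r (x + y) \<le> max (rat_abs p r x) (rat_abs p r y)"
proof (cases "x = 0 \<or> y = 0 \<or> x + y = 0")
  case True
  then show ?thesis using assms by (auto simp: rat_abs_def le_max_iff_disj)
next
  case False
  then have "min (rat_val p x) (rat_val p y) \<le> rat_val p (x + y)"
    using rat_val_add assms by blast
  then have "r powi rat_val p (x + y) \<le> r powi min (rat_val p x) (rat_val p y)"
    using assms by (intro power_int_decreasing) auto
  then show ?thesis using False by (auto simp: rat_abs_def min_def max_def split: if_splits)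
qed

lemma rat_abs_diff:
  assumes "prime p" "0 < r" "r < 1"
  shows "rat_abs p r (x - y) \<le> max (rat_abs p r x) (rat_abs p r y)"
  using rat_abs_add[OF assms, of x "- y"] by simp

lemma rat_abs_abs_diff:
  assumes "prime p" "0 < r" "r < 1"
  shows "\<bar>rat_abs p r x - rat_abs p r y\<bar> \<le> rat_abs p r (x - y)"
  using rat_abs_add[OF assms, of y "x - y"] rat_abs_add[OF assms, of x "y - x"]
    rat_abs_nonneg[OF assms(2), of p "x - y"]
    rat_abs_nonneg[OF assms(2), of p x] rat_abs_nonneg[OF assms(2), of p y]
  by (auto simp: rat_abs_diff_commute[of p r y x] max_def split: if_splits)

lemma rat_abs_self:
  assumes "prime p"
  shows "rat_abs p r (of_nat p) = r"
  using rat_val_frac[OF assms, of "int p" 1] assms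
  by (auto simp: rat_abs_def)

lemma rat_abs_powr:
  assumes "prime p" "0 < r" "r < 1"
  shows "rat_abs p r x = rat_abs p (1 / real p) x powr (ln r / ln (1 / real p))"
proof (cases "x = 0")
  case False
  have p: "real p > 1" using assms(1) prime_gt_1_nat by simp
  have "(1 / real p) powr (ln r / ln (1 / real p)) = r"
    using p assms by (simp add: powr_def)
  moreover have "((1 / real p) powi k) powr s = ((1 / real p) powr s) powi k" for k s
    using p by (simp add: powr_real_of_int'[symmetric] powr_powr mult.commute)
  ultimately show ?thesis using False by (simp add: rat_abs_def)
qed (simp add: rat_abs_def)

subsection \<open>The completion\<close>

text \<open>Whether a sequence is Cauchy or null does not depend on the normalisation; the standard one
  is used here.\<close>

definition padic_cauchy :: "nat \<Rightarrow> (nat \<Rightarrow> rat) set" where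
  "padic_cauchy p =
    {x. \<forall>e>0. \<exists>N. \<forall>m\<ge>N. \<forall>n\<ge>N. rat_abs p (1 / real p) (x m - x n) < e}"

definition padic_null :: "nat \<Rightarrow> (nat \<Rightarrow> rat) set" where
  "padic_null p = {x. (\<lambda>n. rat_abs p (1 / real p) (x n)) \<longlonglongrightarrow> 0}"

definition padic_cauchy_ring :: "nat \<Rightarrow> (nat \<Rightarrow> rat) ring" where
  "padic_cauchy_ring p =
    \<lparr>carrier = padic_cauchy p, mult = (\<lambda>x y n. x n * y n), one = (\<lambda>_. 1),
     zero = (\<lambda>_. 0), add = (\<lambda>x y n. x n + y n)\<rparr>"

type_synonym padic = "(nat \<Rightarrow> rat) set"

definition Qp :: "nat \<Rightarrow> padic ring" where
  "Qp p = padic_cauchy_ring p Quot padic_null p"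

definition padic_of_rat :: "nat \<Rightarrow> rat \<Rightarrow> padic" where
  "padic_of_rat p x = padic_null p +>\<^bsub>padic_cauchy_ring p\<^esub> (\<lambda>_. x)"

definition padic_abs :: "nat \<Rightarrow> real \<Rightarrow> padic \<Rightarrow> real" where
  "padic_abs p r X = (THE l. \<forall>x\<in>X. (\<lambda>n. rat_abs p r (x n)) \<longlonglongrightarrow> l)"

definition Zp :: "nat \<Rightarrow> padic set" where
  "Zp p = {x \<in> carrier (Qp p). padic_abs p (1 / real p) x \<le> 1}"

definition pZp :: "nat \<Rightarrow> padic set" where
  "pZp p = {padic_of_rat p (of_nat p) \<otimes>\<^bsub>Qp p\<^esub> z | z. z \<in> Zp p}"

subsection \<open>Well-definedness\<close>

lemma padic_norm_bounds: "prime p \<Longrightarrow> 0 < 1 / real p" "prime p \<Longrightarrow> 1 / real p < 1"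
  using prime_gt_1_nat[of p] by (auto simp: field_simps)

lemma padic_cauchyE:
  assumes "x \<in> padic_cauchy p" "e > 0"
  obtains N where "\<And>m n. m \<ge> N \<Longrightarrow> n \<ge> N \<Longrightarrow> rat_abs p (1 / real p) (x m - x n) < e"
  using assms unfolding padic_cauchy_def by blast

lemma padic_cauchy_bounded:
  assumes p: "prime p" and x: "x \<in> padic_cauchy p"
  obtains K where "K > 0" "\<And>n. rat_abs p (1 / real p) (x n) \<le> K"
proof -
  let ?a = "rat_abs p (1 / real p)"
  obtain N where N: "\<And>m n. m \<ge> N \<Longrightarrow> n \<ge> N \<Longrightarrow> ?a (x m - x n) < 1"
    by (rule padic_cauchyE[OF x zero_less_one]) blast
  define K where "K = Max ((\<lambda>n. ?a (x n)) ` {..N}) + 1"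
  have le: "?a (x n) + 1 \<le> K" if "n \<le> N" for n
    using that by (auto simp: K_def intro!: Max_ge)
  have "?a (x n) \<le> K" for n
  proof (cases "n \<le> N")
    case False
    have "?a (x n) \<le> ?a (x n - x N) + ?a (x N)"
      using rat_abs_abs_diff[OF p padic_norm_bounds[OF p], of "x n" "x N"] by simp
    then show ?thesis using N[of n N] le[of N] False by force
  qed (use le in force)
  moreover have "K > 0" using le[of 0] rat_abs_nonneg[OF padic_norm_bounds(1)[OF p], of p "x 0"] by simp
  ultimately show ?thesis using that by blast
qed

lemma padic_cauchy_add:
  assumes p: "prime p" and x: "x \<in> padic_cauchy p" and y: "y \<in> padic_cauchy p"
  shows "(\<lambda>n. x n + y n) \<in> padic_cauchy p"
  unfolding padic_cauchy_def
proof (intro CollectI allI impI)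
  let ?a = "rat_abs p (1 / real p)"
  fix e :: real assume e: "e > 0"
  obtain N1 where N1: "\<And>m n. m \<ge> N1 \<Longrightarrow> n \<ge> N1 \<Longrightarrow> ?a (x m - x n) < e"
    by (rule padic_cauchyE[OF x e]) blast
  obtain N2 where N2: "\<And>m n. m \<ge> N2 \<Longrightarrow> n \<ge> N2 \<Longrightarrow> ?a (y m - y n) < e"
    by (rule padic_cauchyE[OF y e]) blast
  have "?a (x m + y m - (x n + y n)) < e" if "m \<ge> max N1 N2" "n \<ge> max N1 N2" for m n
  proof -
    have "x m + y m - (x n + y n) = (x m - x n) + (y m - y n)" by simp
    then have "?a (x m + y m - (x n + y n)) \<le> max (?a (x m - x n)) (?a (y m - y n))"
      using rat_abs_add[OF p padic_norm_bounds[OF p]] by metis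
    also have "\<dots> < e" using N1 N2 that by simp
    finally show ?thesis .
  qed
  then show "\<exists>N. \<forall>m\<ge>N. \<forall>n\<ge>N. ?a (x m + y m - (x n + y n)) < e" by blast
qed

lemma padic_cauchy_mult:
  assumes p: "prime p" and x: "x \<in> padic_cauchy p" and y: "y \<in> padic_cauchy p"
  shows "(\<lambda>n. x n * y n) \<in> padic_cauchy p"
  unfolding padic_cauchy_def
proof (intro CollectI allI impI)
  let ?a = "rat_abs p (1 / real p)"
  fix e :: real assume e: "e > 0"
  obtain K where K: "K > 0" "\<And>n. ?a (x n) \<le> K" by (rule padic_cauchy_bounded[OF p x]) blast
  obtain L where L: "L > 0" "\<And>n. ?a (y n) \<le> L" by (rule padic_cauchy_bounded[OF p y]) blast
  have eL: "e / L > 0" and eK: "e / K > 0" using e K L by auto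
  obtain N1 where N1: "\<And>m n. m \<ge> N1 \<Longrightarrow> n \<ge> N1 \<Longrightarrow> ?a (x m - x n) < e / L"
    by (rule padic_cauchyE[OF x eL]) blast
  obtain N2 where N2: "\<And>m n. m \<ge> N2 \<Longrightarrow> n \<ge> N2 \<Longrightarrow> ?a (y m - y n) < e / K"
    by (rule padic_cauchyE[OF y eK]) blast
  have "?a (x m * y m - x n * y n) < e" if mn: "m \<ge> max N1 N2" "n \<ge> max N1 N2" for m n
  proof -
    note nn = rat_abs_nonneg[OF padic_norm_bounds(1)[OF p], of p]
    have "x m * y m - x n * y n = x m * (y m - y n) + (x m - x n) * y n"
      by (simp add: algebra_simps)
    then have "?a (x m * y m - x n * y n) \<le> max (?a (x m) * ?a (y m - y n)) (?a (x m - x n) * ?a (y n))"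
      using rat_abs_add[OF p padic_norm_bounds[OF p]] rat_abs_mult[OF p padic_norm_bounds(1)[OF p]] by metis
    moreover have "?a (x m) * ?a (y m - y n) \<le> K * ?a (y m - y n)"
      using K nn by (intro mult_right_mono) auto
    moreover have "K * ?a (y m - y n) < e" using N2[of m n] mn K by (simp add: field_simps)
    moreover have "?a (x m - x n) * ?a (y n) \<le> ?a (x m - x n) * L"
      using L nn by (intro mult_left_mono) auto
    moreover have "?a (x m - x n) * L < e" using N1[of m n] mn L by (simp add: field_simps)
    ultimately show ?thesis by linarith
  qed
  then show "\<exists>N. \<forall>m\<ge>N. \<forall>n\<ge>N. ?a (x m * y m - x n * y n) < e" by blast
qed

lemma padic_cauchy_const: "(\<lambda>_. c) \<in> padic_cauchy p"
  by (simp add: padic_cauchy_def)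

lemma padic_cauchy_uminus:
  "x \<in> padic_cauchy p \<Longrightarrow> (\<lambda>n. - x n) \<in> padic_cauchy p"
  by (simp add: padic_cauchy_def rat_abs_diff_commute)

lemma padic_cauchy_ring_cring:
  assumes p: "prime p"
  shows "cring (padic_cauchy_ring p)"
proof (rule cringI)
  show "abelian_group (padic_cauchy_ring p)"
  proof (rule abelian_groupI)
    fix x assume "x \<in> carrier (padic_cauchy_ring p)"
    then show "\<exists>y\<in>carrier (padic_cauchy_ring p). y \<oplus>\<^bsub>padic_cauchy_ring p\<^esub> x = \<zero>\<^bsub>padic_cauchy_ring p\<^esub>"
      by (intro bexI[of _ "\<lambda>n. - x n"]) (auto simp: padic_cauchy_ring_def padic_cauchy_uminus)
  qed (auto simp: padic_cauchy_ring_def padic_cauchy_add[OF p] padic_cauchy_const add_ac)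
  show "Group.comm_monoid (padic_cauchy_ring p)"
    by (rule comm_monoidI)
      (auto simp: padic_cauchy_ring_def padic_cauchy_mult[OF p] padic_cauchy_const mult_ac)
qed (auto simp: padic_cauchy_ring_def algebra_simps)

lemma padic_null_subset:
  assumes p: "prime p"
  shows "padic_null p \<subseteq> padic_cauchy p"
proof
  let ?a = "rat_abs p (1 / real p)"
  fix x assume x: "x \<in> padic_null p"
  show "x \<in> padic_cauchy p"
    unfolding padic_cauchy_def
  proof (intro CollectI allI impI)
    fix e :: real assume "e > 0"
    then obtain N where N: "\<And>n. n \<ge> N \<Longrightarrow> ?a (x n) < e"
      using order_tendstoD(2)[of "\<lambda>n. ?a (x n)" 0 sequentially e] x
      by (auto simp: padic_null_def eventually_sequentially)
    then have "?a (x m - x n) < e" if "m \<ge> N" "n \<ge> N" for m n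
      using rat_abs_diff[OF p padic_norm_bounds[OF p], of "x m" "x n"] that
      by (meson le_less_trans max_less_iff_conj)
    then show "\<exists>N. \<forall>m\<ge>N. \<forall>n\<ge>N. ?a (x m - x n) < e" by blast
  qed
qed

lemma padic_null_add:
  assumes p: "prime p" and "x \<in> padic_null p" "y \<in> padic_null p"
  shows "(\<lambda>n. x n + y n) \<in> padic_null p"
proof -
  let ?a = "rat_abs p (1 / real p)"
  have lim: "(\<lambda>n. max (?a (x n)) (?a (y n))) \<longlonglongrightarrow> 0"
    using assms by (subst max.idem[of 0, symmetric], intro tendsto_max) (auto simp: padic_null_def)
  have "(\<lambda>n. ?a (x n + y n)) \<longlonglongrightarrow> 0"
    by (rule tendsto_sandwich[OF _ _ tendsto_const lim])
      (use rat_abs_add[OF p padic_norm_bounds[OF p]] rat_abs_nonneg[OF padic_norm_bounds(1)[OF p]]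
        in auto)
  then show ?thesis by (simp add: padic_null_def)
qed

lemma padic_null_mult:
  assumes p: "prime p" and "x \<in> padic_null p" "y \<in> padic_cauchy p"
  shows "(\<lambda>n. x n * y n) \<in> padic_null p"
proof -
  let ?a = "rat_abs p (1 / real p)"
  note nn = rat_abs_nonneg[OF padic_norm_bounds(1)[OF p], of p]
  obtain L where L: "L > 0" "\<And>n. ?a (y n) \<le> L" by (rule padic_cauchy_bounded[OF p assms(3)]) blast
  have lim: "(\<lambda>n. ?a (x n) * L) \<longlonglongrightarrow> 0"
    using assms by (intro tendsto_mult_left_zero) (auto simp: padic_null_def)
  have "(\<lambda>n. ?a (x n * y n)) \<longlonglongrightarrow> 0"
    by (rule tendsto_sandwich[OF _ _ tendsto_const lim])
      (use rat_abs_mult[OF p padic_norm_bounds(1)[OF p]] nn L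
        in \<open>auto intro!: always_eventually mult_left_mono\<close>)
  then show ?thesis by (simp add: padic_null_def)
qed

lemma padic_null_ideal:
  assumes p: "prime p"
  shows "ideal (padic_null p) (padic_cauchy_ring p)"
proof -
  interpret cring "padic_cauchy_ring p" by (rule padic_cauchy_ring_cring[OF p])
  have inv: "\<ominus>\<^bsub>padic_cauchy_ring p\<^esub> x = (\<lambda>n. - x n)" if "x \<in> padic_cauchy p" for x
    using that by (intro minus_equality)
      (auto simp: padic_cauchy_ring_def padic_cauchy_uminus)
  show ?thesis
  proof (rule idealI)
    show "subgroup (padic_null p) (add_monoid (padic_cauchy_ring p))"
    proof (rule add.subgroupI)
      show "padic_null p \<noteq> {}"
        by (auto simp: padic_null_def intro!: exI[of _ "\<lambda>_. 0"])
      fix x assume x: "x \<in> padic_null p"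
      then have "x \<in> padic_cauchy p" using padic_null_subset[OF p] by blast
      then show "\<ominus>\<^bsub>padic_cauchy_ring p\<^esub> x \<in> padic_null p"
        using x by (simp add: inv padic_null_def)
    qed (use padic_null_subset[OF p] padic_null_add[OF p] in
        \<open>auto simp: padic_cauchy_ring_def\<close>)
  qed (use padic_null_mult[OF p] ring_axioms in \<open>auto simp: padic_cauchy_ring_def mult.commute\<close>)
qed

lemma Qp_cring: "prime p \<Longrightarrow> cring (Qp p)"
  unfolding Qp_def by (intro ideal.quotient_is_cring padic_null_ideal padic_cauchy_ring_cring)

lemma Qp_carrier:
  "carrier (Qp p) = (\<lambda>x. padic_null p +>\<^bsub>padic_cauchy_ring p\<^esub> x) ` padic_cauchy p"
proof -
  have "carrier (padic_cauchy_ring p) = padic_cauchy p" by (simp add: padic_cauchy_ring_def)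
  then show ?thesis by (auto simp: Qp_def FactRing_def A_RCOSETS_def')
qed

lemma Qp_carrier_cases:
  assumes "X \<in> carrier (Qp p)"
  obtains x where "x \<in> padic_cauchy p" "X = padic_null p +>\<^bsub>padic_cauchy_ring p\<^esub> x"
  using assms by (auto simp: Qp_carrier)

lemma padic_of_rat_closed: "padic_of_rat p x \<in> carrier (Qp p)"
  using padic_cauchy_const[of x p] by (auto simp: padic_of_rat_def Qp_carrier)

lemma padic_cauchy_abs_convergent:
  assumes p: "prime p" and r: "0 < r" "r < 1" and x: "x \<in> padic_cauchy p"
  shows "convergent (\<lambda>n. rat_abs p r (x n))"
proof -
  let ?a = "rat_abs p (1 / real p)" and ?s = "ln r / ln (1 / real p)"
  have "Cauchy (\<lambda>n. ?a (x n))"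
  proof (rule metric_CauchyI)
    fix e :: real assume e: "e > 0"
    obtain N where "\<And>m n. m \<ge> N \<Longrightarrow> n \<ge> N \<Longrightarrow> ?a (x m - x n) < e"
      by (rule padic_cauchyE[OF x e]) blast
    then show "\<exists>N. \<forall>m\<ge>N. \<forall>n\<ge>N. dist (?a (x m)) (?a (x n)) < e"
      using rat_abs_abs_diff[OF p padic_norm_bounds[OF p]]
      by (metis dist_real_def le_less_trans)
  qed
  then obtain l where l: "(\<lambda>n. ?a (x n)) \<longlonglongrightarrow> l"
    using Cauchy_convergent_iff convergent_def by blast
  have "real p > 1" using p prime_gt_1_nat by simp
  then have s: "?s > 0" using r by (intro divide_neg_neg) auto
  have "(\<lambda>n. ?a (x n) powr ?s) \<longlonglongrightarrow> l powr ?s"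
    using l s rat_abs_nonneg[OF padic_norm_bounds(1)[OF p]]
    by (intro tendsto_powr' tendsto_const) auto
  then show ?thesis
    unfolding convergent_def rat_abs_powr[OF p r] by blast
qed

lemma padic_abs_tendsto:
  assumes p: "prime p" and r: "0 < r" "r < 1" and X: "X \<in> carrier (Qp p)" and x: "x \<in> X"
  shows "(\<lambda>n. rat_abs p r (x n)) \<longlonglongrightarrow> padic_abs p r X"
proof -
  obtain x0 where x0: "x0 \<in> padic_cauchy p" "X = padic_null p +>\<^bsub>padic_cauchy_ring p\<^esub> x0"
    using X by (rule Qp_carrier_cases)
  obtain l where l: "(\<lambda>n. rat_abs p r (x0 n)) \<longlonglongrightarrow> l"
    using padic_cauchy_abs_convergent[OF p r x0(1)] convergent_def by blast
  have all: "(\<lambda>n. rat_abs p r (y n)) \<longlonglongrightarrow> l" if y: "y \<in> X" for y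
  proof -
    let ?s = "ln r / ln (1 / real p)"
    obtain h where h: "h \<in> padic_null p" "y = (\<lambda>n. h n + x0 n)"
      using y by (auto simp: x0(2) a_r_coset_def r_coset_def padic_cauchy_ring_def)
    have "real p > 1" using p prime_gt_1_nat by simp
    then have s: "?s > 0" using r by (intro divide_neg_neg) auto
    have "(\<lambda>n. rat_abs p (1 / real p) (h n) powr ?s) \<longlonglongrightarrow> 0 powr ?s"
      using h(1) s rat_abs_nonneg[OF padic_norm_bounds(1)[OF p]]
      by (intro tendsto_powr' tendsto_const) (auto simp: padic_null_def)
    then have h0: "(\<lambda>n. rat_abs p r (h n)) \<longlonglongrightarrow> 0"
      using s by (simp add: rat_abs_powr[OF p r])
    have "(\<lambda>n. rat_abs p r (y n) - rat_abs p r (x0 n)) \<longlonglongrightarrow> 0"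
    proof (rule tendsto_0_le[OF h0, where K = 1])
      have "\<bar>rat_abs p r (y n) - rat_abs p r (x0 n)\<bar> \<le> rat_abs p r (h n)" for n
        using rat_abs_abs_diff[OF p r, of "y n" "x0 n"] by (simp add: h(2))
      then show "\<forall>\<^sub>F n in sequentially.
          norm (rat_abs p r (y n) - rat_abs p r (x0 n)) \<le> norm (rat_abs p r (h n)) * 1"
        using rat_abs_nonneg[OF r(1), of p] by simp
    qed
    from tendsto_add[OF this l] show ?thesis by simp
  qed
  have "padic_abs p r X = l"
    unfolding padic_abs_def
    using all x by (intro the_equality) (auto intro: LIMSEQ_unique)
  then show ?thesis using all[OF x] by simp
qed

lemma padic_abs_of_rat:
  assumes p: "prime p" and r: "0 < r" "r < 1"
  shows "padic_abs p r (padic_of_rat p x) = rat_abs p r x"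
proof -
  have "(\<lambda>_. x) \<in> padic_of_rat p x"
    by (auto simp: padic_of_rat_def a_r_coset_def r_coset_def padic_cauchy_ring_def padic_null_def
        intro!: exI[of _ "\<lambda>_. 0"])
  from padic_abs_tendsto[OF p r padic_of_rat_closed this] show ?thesis
    by (simp add: LIMSEQ_const_iff)
qed

lemma padic_abs_self:
  "prime p \<Longrightarrow> 0 < r \<Longrightarrow> r < 1 \<Longrightarrow> padic_abs p r (padic_of_rat p (of_nat p)) = r"
  by (simp add: padic_abs_of_rat rat_abs_self)

section \<open>Vectors and residues\<close>

type_synonym padic_vec = "nat \<Rightarrow> padic"

definition Qp_vec :: "nat \<Rightarrow> nat \<Rightarrow> padic_vec set" where
  "Qp_vec p n = {..<n} \<rightarrow>\<^sub>E carrier (Qp p)"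

text \<open>The integers \<open>0, \<dots>, p - 1\<close>, viewed as elements of the p-adic field.\<close>

definition digits :: "nat \<Rightarrow> padic set" where
  "digits p = (\<lambda>b. padic_of_rat p (of_nat b)) ` {0..<p}"

text \<open>The set \<open>C + p Z\<^sub>p\<^sup>n\<close>.\<close>

definition thicken :: "nat \<Rightarrow> nat \<Rightarrow> padic_vec set \<Rightarrow> padic_vec set" where
  "thicken p n C = {\<lambda>d\<in>{..<n}. c d \<oplus>\<^bsub>Qp p\<^esub> z d | c z. c \<in> C \<and> z \<in> {..<n} \<rightarrow>\<^sub>E pZp p}"

text \<open>Entrywise reduction; only meaningful for vectors with entries in \<open>Zp p\<close>.\<close>

definition vec_mod :: "nat \<Rightarrow> nat \<Rightarrow> padic_vec \<Rightarrow> padic_vec" where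
  "vec_mod p n x =
    (THE y. y \<in> {..<n} \<rightarrow>\<^sub>E digits p \<and> (\<forall>d<n. x d \<ominus>\<^bsub>Qp p\<^esub> y d \<in> pZp p))"

section \<open>p-adic optimisations\<close>

text \<open>A p-adic optimisation of dimension \<open>n\<close> is a function on \<open>Qp_vec p n\<close>; the values of
  \<open>objective\<close> outside that set are irrelevant and are never used.\<close>

datatype padic_opt =
  Padic_Opt (opt_dim: nat) (objective: "padic_vec \<Rightarrow> ennreal")

text \<open>Optimal solutions of \<open>OP(l, C)\<close>; those of \<open>OP(l)\<close> are obtained with
  \<open>C = Qp_vec p (opt_dim l)\<close>.\<close>

definition optimal_on :: "padic_opt \<Rightarrow> padic_vec set \<Rightarrow> padic_vec \<Rightarrow> bool" where
  "optimal_on l C c \<longleftrightarrow> c \<in> C \<and> (\<forall>c'\<in>C. objective l c \<le> objective l c')"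

definition optimal :: "nat \<Rightarrow> padic_opt \<Rightarrow> padic_vec \<Rightarrow> bool" where
  "optimal p l c \<longleftrightarrow> optimal_on l (Qp_vec p (opt_dim l)) c"

definition one_reducible :: "nat \<Rightarrow> padic_vec set \<Rightarrow> padic_opt \<Rightarrow> bool" where
  "one_reducible p C l \<longleftrightarrow>
    (\<forall>c. optimal_on l C c \<longrightarrow> optimal p l c) \<and>
    (\<forall>c. optimal p l c \<longrightarrow>
      c \<in> thicken p (opt_dim l) C \<and> optimal_on l C (vec_mod p (opt_dim l) c))"

definition seq_dim :: "padic_opt list \<Rightarrow> nat" where
  "seq_dim ls = (if length ls > 0 then opt_dim (ls ! 0) else 0)"

definition seq_sum :: "padic_opt list \<Rightarrow> padic_opt" where
  "seq_sum ls = Padic_Opt (seq_dim ls) (\<lambda>c. \<Sum>i<length ls. objective (ls ! i) c)"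

definition concentrated :: "nat \<Rightarrow> padic_opt list \<Rightarrow> padic_vec set \<Rightarrow> bool" where
  "concentrated p ls C \<longleftrightarrow>
    (\<forall>i<length ls. \<forall>c\<in>thicken p (seq_dim ls) C.
      (objective (ls ! i) c \<ge> 1 \<longleftrightarrow> objective (ls ! i) (vec_mod p (seq_dim ls) c) = 1) \<and>
      (objective (ls ! i) (vec_mod p (seq_dim ls) c) = 1 \<longleftrightarrow>
        objective (ls ! i) (vec_mod p (seq_dim ls) c) > 0))"

end

theory Submission
  imports Defs
begin

text \<open>Distinct digits differ by a unit, and \<open>w\<close> is at least 1 off \<open>pZp\<close>. Hence
  the penalty \<open>\<Sum>b\<in>B d. w (x \<ominus> b)\<close> of a single coordinate is always at least
  \<open>card (B d) - 1\<close>, with equality at the points of \<open>B d\<close>, and it is at least \<open>card (B d)\<close>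
  when \<open>x\<close> is congruent to no element of \<open>B d\<close>. As the objective is below \<open>M\<close> on \<open>C\<close>, leaving
  \<open>thicken p n C\<close> costs more than can be gained, while inside it concentration shows that
  reduction modulo \<open>p\<close> does not increase the objective.\<close>

section \<open>The absolute value on the p-adic field\<close>

text \<open>The quotient map onto the field, named so that operations on classes can be computed on
  representing sequences.\<close>

definition padic_class :: "nat \<Rightarrow> (nat \<Rightarrow> rat) \<Rightarrow> padic" where
  "padic_class p x = padic_null p +>\<^bsub>padic_cauchy_ring p\<^esub> x"

lemma padic_class_cases:
  assumes "X \<in> carrier (Qp p)"
  obtains x where "x \<in> padic_cauchy p" "X = padic_class p x"
  using assms by (auto simp: padic_class_def elim: Qp_carrier_cases)

lemma padic_class_closed: "x \<in> padic_cauchy p \<Longrightarrow> padic_class p x \<in> carrier (Qp p)"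
  by (auto simp: padic_class_def Qp_carrier)

lemma padic_of_rat_eq_class: "padic_of_rat p x = padic_class p (\<lambda>_. x)"
  by (simp add: padic_of_rat_def padic_class_def)

lemma padic_class_hom:
  assumes "prime p"
  shows "ring_hom_ring (padic_cauchy_ring p) (Qp p) (padic_class p)"
proof -
  have "padic_class p = (+>\<^bsub>padic_cauchy_ring p\<^esub>) (padic_null p)"
    by (simp add: padic_class_def fun_eq_iff)
  then show ?thesis
    using ideal.rcos_ring_hom_ring[OF padic_null_ideal[OF assms]] by (simp add: Qp_def)
qed

lemma padic_class_mult:
  assumes "prime p" "x \<in> padic_cauchy p" "y \<in> padic_cauchy p"
  shows "padic_class p x \<otimes>\<^bsub>Qp p\<^esub> padic_class p y = padic_class p (\<lambda>n. x n * y n)"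
  using ring_hom_mult[OF ring_hom_ring.homh[OF padic_class_hom[OF assms(1)]], of x y] assms
  by (simp add: padic_cauchy_ring_def)

lemma padic_class_diff:
  assumes p: "prime p" and x: "x \<in> padic_cauchy p" and y: "y \<in> padic_cauchy p"
  shows "padic_class p x \<ominus>\<^bsub>Qp p\<^esub> padic_class p y = padic_class p (\<lambda>n. x n - y n)"
proof -
  interpret ring_hom_ring "padic_cauchy_ring p" "Qp p" "padic_class p"
    by (rule padic_class_hom[OF p])
  have c: "carrier (padic_cauchy_ring p) = padic_cauchy p" by (simp add: padic_cauchy_ring_def)
  have "\<ominus>\<^bsub>padic_cauchy_ring p\<^esub> y = (\<lambda>n. - y n)"
    using y by (intro R.minus_equality) (auto simp: padic_cauchy_ring_def padic_cauchy_uminus)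
  \<comment> \<open>The negative is substituted while the ring is still folded; unfolding the record
    then evaluates the addition.\<close>
  then have "x \<ominus>\<^bsub>padic_cauchy_ring p\<^esub> y = (\<lambda>n. x n - y n)"
    by (simp add: a_minus_def) (simp add: padic_cauchy_ring_def)
  moreover have "padic_class p x \<ominus>\<^bsub>Qp p\<^esub> padic_class p y
      = padic_class p (x \<ominus>\<^bsub>padic_cauchy_ring p\<^esub> y)"
    using x[folded c] y[folded c] by (simp add: a_minus_def)
  ultimately show ?thesis by simp
qed

lemma padic_cauchy_diff:
  assumes "prime p" "x \<in> padic_cauchy p" "y \<in> padic_cauchy p"
  shows "(\<lambda>n. x n - y n) \<in> padic_cauchy p"
  using padic_cauchy_add[OF assms(1,2) padic_cauchy_uminus[OF assms(3)]] by simp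

text \<open>Any representative computes the absolute value, and a sequence represents its own class:
  the null summand is the zero sequence.\<close>

lemma padic_abs_class:
  assumes "prime p" "0 < r" "r < 1" "x \<in> padic_cauchy p"
  shows "(\<lambda>n. rat_abs p r (x n)) \<longlonglongrightarrow> padic_abs p r (padic_class p x)"
proof (rule padic_abs_tendsto[OF assms(1-3) padic_class_closed[OF assms(4)]])
  show "x \<in> padic_class p x"
    by (auto simp: padic_class_def a_r_coset_def r_coset_def padic_cauchy_ring_def padic_null_def
        intro!: exI[of _ "\<lambda>_. 0"])
qed

text \<open>The ultrametric inequality holds termwise for representatives and survives the limit
  because \<open>max\<close> is continuous.\<close>

lemma padic_abs_diff:
  assumes p: "prime p" and r: "0 < r" "r < 1"
    and X: "X \<in> carrier (Qp p)" and Y: "Y \<in> carrier (Qp p)"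
  shows "padic_abs p r (X \<ominus>\<^bsub>Qp p\<^esub> Y) \<le> max (padic_abs p r X) (padic_abs p r Y)"
proof -
  obtain x where x: "x \<in> padic_cauchy p" "X = padic_class p x" using X by (rule padic_class_cases)
  obtain y where y: "y \<in> padic_cauchy p" "Y = padic_class p y" using Y by (rule padic_class_cases)
  have "(\<lambda>n. rat_abs p r (x n - y n)) \<longlonglongrightarrow> padic_abs p r (X \<ominus>\<^bsub>Qp p\<^esub> Y)"
    using padic_abs_class[OF p r padic_cauchy_diff[OF p x(1) y(1)]]
    by (simp add: x y padic_class_diff[OF p])
  moreover have "(\<lambda>n. max (rat_abs p r (x n)) (rat_abs p r (y n)))
      \<longlonglongrightarrow> max (padic_abs p r X) (padic_abs p r Y)"
    unfolding x y by (intro tendsto_max padic_abs_class[OF p r] x y)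
  ultimately show ?thesis
    using rat_abs_diff[OF p r] by (intro LIMSEQ_le) auto
qed

text \<open>Powers of \<open>r\<close> decrease with the exponent. The right-hand side is free of
  \<open>r\<close>, which allows passing between normalisations. Zero is separate because
  \<open>rat_val p 0\<close> is an integer instead of infinity.\<close>

lemma rat_abs_le_iff:
  assumes "0 < r" "r < 1"
  shows "rat_abs p r x \<le> r powi k \<longleftrightarrow> x = 0 \<or> k \<le> rat_val p x"
proof (cases "x = 0")
  case False
  have "r powi rat_val p x \<le> r powi k" if "k \<le> rat_val p x"
    using that assms by (intro power_int_decreasing) auto
  moreover have "r powi k < r powi rat_val p x" if "\<not> k \<le> rat_val p x"
    using that assms by (intro power_int_strict_decreasing) auto
  ultimately show ?thesis using False by (simp add: rat_abs_def) (meson leD)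
qed (use assms in simp)

lemma rat_abs_less_iff:
  assumes "0 < r" "r < 1"
  shows "rat_abs p r x < r powi k \<longleftrightarrow> x = 0 \<or> k < rat_val p x"
proof (cases "x = 0")
  case False
  have "r powi rat_val p x < r powi k" if "k < rat_val p x"
    using that assms by (intro power_int_strict_decreasing) auto
  moreover have "r powi k \<le> r powi rat_val p x" if "\<not> k < rat_val p x"
    using that assms by (intro power_int_decreasing) auto
  ultimately show ?thesis using False by (simp add: rat_abs_def) (meson leD)
qed (use assms in simp)

text \<open>The definition of \<open>pZp\<close> uses the standard normalisation; \<open>r\<close> is arbitrary here.\<close>

lemma pZp_iff:
  assumes p: "prime p" and r: "0 < r" "r < 1"
  shows "X \<in> pZp p \<longleftrightarrow> X \<in> carrier (Qp p) \<and> padic_abs p r X < 1"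
proof
  note q = padic_norm_bounds[OF p]
  assume "X \<in> pZp p"
  then obtain Z where Z: "Z \<in> carrier (Qp p)" "padic_abs p (1 / real p) Z \<le> 1"
    and X: "X = padic_of_rat p (of_nat p) \<otimes>\<^bsub>Qp p\<^esub> Z"
    by (auto simp: pZp_def Zp_def)
  obtain z where z: "z \<in> padic_cauchy p" "Z = padic_class p z" using Z(1) by (rule padic_class_cases)
  have pz: "(\<lambda>n. of_nat p * z n) \<in> padic_cauchy p"
    by (rule padic_cauchy_mult[OF p padic_cauchy_const z(1)])
  have Xc: "X = padic_class p (\<lambda>n. of_nat p * z n)"
    by (simp add: X z padic_of_rat_eq_class padic_class_mult[OF p padic_cauchy_const])
  \<comment> \<open>A bound by 1 on the limit need not hold for the terms. Being strictly below
    \<open>p\<close> is an open condition, so it holds eventually, and integrality of the valuation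
    turns it back into valuation at least 0.\<close>
  have "padic_abs p (1 / real p) Z < (1 / real p) powi (-1)"
    using Z(2) prime_gt_1_nat[OF p] by (simp add: power_int_minus)
  then have ev: "\<forall>\<^sub>F n in sequentially. rat_abs p (1 / real p) (z n) < (1 / real p) powi (-1)"
    using order_tendstoD(2)[OF padic_abs_class[OF p q z(1)]] z(2) by simp
  \<comment> \<open>The bound is \<open>r\<close> and not merely strict inequality with 1, since
    only a non-strict bound survives the limit.\<close>
  have "\<forall>\<^sub>F n in sequentially. rat_abs p r (of_nat p * z n) \<le> r"
    using ev
  proof eventually_elim
    case (elim n)
    then have "z n = 0 \<or> 0 \<le> rat_val p (z n)" unfolding rat_abs_less_iff[OF q] by auto
    then have "rat_abs p r (z n) \<le> r powi 0" unfolding rat_abs_le_iff[OF r] .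
    then show ?case using r(1) by (simp add: rat_abs_mult[OF p r(1)] rat_abs_self[OF p])
  qed
  then have "padic_abs p r X \<le> r"
    using padic_abs_class[OF p r pz] unfolding Xc
    by (intro tendsto_upperbound) auto
  then show "X \<in> carrier (Qp p) \<and> padic_abs p r X < 1"
    using r(2) padic_class_closed[OF pz] Xc by auto
next
  note q = padic_norm_bounds[OF p]
  assume X: "X \<in> carrier (Qp p) \<and> padic_abs p r X < 1"
  then obtain x where x: "x \<in> padic_cauchy p" "X = padic_class p x" by (blast elim: padic_class_cases)
  have ev: "\<forall>\<^sub>F n in sequentially. rat_abs p r (x n) < 1"
    using order_tendstoD(2)[OF padic_abs_class[OF p r x(1)]] X x(2) by simp
  \<comment> \<open>Division by \<open>p\<close>: the terms \<open>x n\<close> eventually have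
    valuation at least 1, so the quotients are eventually integral.\<close>
  define z where "z = (\<lambda>n. inverse (of_nat p) * x n)"
  have z: "z \<in> padic_cauchy p"
    unfolding z_def by (rule padic_cauchy_mult[OF p padic_cauchy_const x(1)])
  have p0: "(of_nat p :: rat) \<noteq> 0" using p by (auto simp: prime_gt_0_nat)
  have pz: "of_nat p * z n = x n" for n using p0 by (simp add: z_def)
  have "\<forall>\<^sub>F n in sequentially. rat_abs p (1 / real p) (z n) \<le> 1"
    using ev
  proof eventually_elim
    case (elim n)
    then have "rat_abs p r (x n) < r powi 0" by simp
    then have "x n = 0 \<or> 1 \<le> rat_val p (x n)" unfolding rat_abs_less_iff[OF r] by auto
    then have "rat_abs p (1 / real p) (x n) \<le> (1 / real p) powi 1" unfolding rat_abs_le_iff[OF q] .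
    then have "1 / real p * rat_abs p (1 / real p) (z n) \<le> 1 / real p * 1"
      using rat_abs_mult[OF p q(1), of "of_nat p" "z n"] by (simp add: pz rat_abs_self[OF p])
    then show ?case using q(1) by (simp only: mult_le_cancel_left_pos)
  qed
  then have "padic_abs p (1 / real p) (padic_class p z) \<le> 1"
    using padic_abs_class[OF p q z] by (intro tendsto_upperbound) auto
  then have "padic_class p z \<in> Zp p" by (simp add: Zp_def padic_class_closed[OF z])
  moreover have "X = padic_of_rat p (of_nat p) \<otimes>\<^bsub>Qp p\<^esub> padic_class p z"
    by (simp add: padic_of_rat_eq_class padic_class_mult[OF p padic_cauchy_const z] pz x(2))
  ultimately show "X \<in> pZp p" by (auto simp: pZp_def)
qed

lemma pZp_closed: "prime p \<Longrightarrow> X \<in> pZp p \<Longrightarrow> X \<in> carrier (Qp p)"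
  \<comment> \<open>The normalisation is arbitrary; 1/2 is a concrete choice, here and
    below.\<close>
  using pZp_iff[of p "1/2"] by simp

lemma pZp_diff:
  assumes p: "prime p" and "X \<in> pZp p" "Y \<in> pZp p"
  shows "X \<ominus>\<^bsub>Qp p\<^esub> Y \<in> pZp p"
proof -
  interpret Q: cring "Qp p" by (rule Qp_cring[OF p])
  show ?thesis
    using assms padic_abs_diff[OF p, of "1/2" X Y] by (auto simp: pZp_iff[OF p, of "1/2"])
qed

lemma padic_of_rat_diff:
  assumes "prime p"
  shows "padic_of_rat p x \<ominus>\<^bsub>Qp p\<^esub> padic_of_rat p y = padic_of_rat p (x - y)"
  by (simp add: padic_of_rat_eq_class padic_class_diff[OF assms padic_cauchy_const padic_cauchy_const])

text \<open>Makes \<open>padic_abs_of_rat\<close> applicable to the zero of the quotient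
  ring.\<close>

lemma zero_Qp:
  assumes "prime p"
  shows "\<zero>\<^bsub>Qp p\<^esub> = padic_of_rat p 0"
proof -
  interpret Q: cring "Qp p" by (rule Qp_cring[OF assms])
  have "\<zero>\<^bsub>Qp p\<^esub> = padic_of_rat p 0 \<ominus>\<^bsub>Qp p\<^esub> padic_of_rat p 0"
    using Q.r_neg[OF padic_of_rat_closed] by (simp add: a_minus_def)
  then show ?thesis by (simp add: padic_of_rat_diff[OF assms])
qed

section \<open>Digits and the penalty term\<close>

lemma finite_digits: "finite (digits p)"
  by (simp add: digits_def)

lemma digits_closed: "a \<in> digits p \<Longrightarrow> a \<in> carrier (Qp p)"
  by (auto simp: digits_def padic_of_rat_closed)

text \<open>The indices differ by a non-zero integer of size below \<open>p\<close>, so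
  \<open>p\<close> does not divide it and its valuation is 0, whatever \<open>r\<close> is.\<close>

lemma padic_abs_digit_diff:
  assumes p: "prime p" and r: "0 < r" "r < 1"
    and ab: "a \<in> digits p" "b \<in> digits p" "a \<noteq> b"
  shows "padic_abs p r (a \<ominus>\<^bsub>Qp p\<^esub> b) = 1"
proof -
  obtain i j where i: "i < p" "a = padic_of_rat p (of_nat i)"
    and j: "j < p" "b = padic_of_rat p (of_nat j)" using ab(1,2) by (auto simp: digits_def)
  have ne: "int i - int j \<noteq> 0" using ab(3) i(2) j(2) by auto
  have "\<not> int p dvd int i - int j"
    using zdvd_imp_le[of "int p" "\<bar>int i - int j\<bar>"] ne i(1) j(1) by auto
  then have "rat_val p (of_int (int i - int j) / of_int 1) = 0"
    using rat_val_frac[OF p ne, of 1] by (simp add: not_dvd_imp_multiplicity_0)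
  then show ?thesis
    using ne by (simp add: i(2) j(2) padic_of_rat_diff[OF p] padic_abs_of_rat[OF p r] rat_abs_def)
qed

text \<open>Otherwise \<open>a\<close> and \<open>b\<close> would differ by an element of
  \<open>pZp\<close>, although their difference has absolute value 1. This is the uniqueness behind
  \<open>vec_mod\<close> and \<open>penalty_ge\<close>.\<close>

lemma digits_cong_eq:
  assumes p: "prime p" and "a \<in> digits p" "b \<in> digits p"
    and x: "x \<in> carrier (Qp p)" and "x \<ominus>\<^bsub>Qp p\<^esub> a \<in> pZp p" "x \<ominus>\<^bsub>Qp p\<^esub> b \<in> pZp p"
  shows "a = b"
proof (rule ccontr)
  assume "a \<noteq> b"
  interpret Q: cring "Qp p" by (rule Qp_cring[OF p])
  have ab: "a \<in> carrier (Qp p)" "b \<in> carrier (Qp p)" using assms digits_closed by auto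
  have "(x \<ominus>\<^bsub>Qp p\<^esub> b) \<ominus>\<^bsub>Qp p\<^esub> (x \<ominus>\<^bsub>Qp p\<^esub> a) = a \<ominus>\<^bsub>Qp p\<^esub> b"
    using x ab by algebra
  then have "a \<ominus>\<^bsub>Qp p\<^esub> b \<in> pZp p" using pZp_diff[OF p] assms by metis
  then show False
    using padic_abs_digit_diff[OF p, of "1/2" a b] assms \<open>a \<noteq> b\<close>
    by (simp add: pZp_iff[OF p, of "1/2"])
qed

lemma ennreal_sum_ge_card:
  assumes "\<And>b. b \<in> B \<Longrightarrow> (1 :: ennreal) \<le> f b"
  shows "of_nat (card B) \<le> sum f B"
  using sum_mono[of B "\<lambda>_. 1" f] assms by simp

context
  fixes p :: nat and w :: "padic \<Rightarrow> real"
  assumes p: "prime p"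
    and w_ge: "\<And>x. x \<in> carrier (Qp p) \<Longrightarrow> x \<notin> pZp p \<Longrightarrow> 1 \<le> w x"
begin

text \<open>Each summand is at least 1 by \<open>w_ge\<close>, a property that both weights of the
  theorem share.\<close>

lemma penalty_ge_card:
  assumes "B \<subseteq> digits p" "x \<in> carrier (Qp p)" "\<And>b. b \<in> B \<Longrightarrow> x \<ominus>\<^bsub>Qp p\<^esub> b \<notin> pZp p"
  shows "of_nat (card B) \<le> (\<Sum>b\<in>B. ennreal (w (x \<ominus>\<^bsub>Qp p\<^esub> b)))"
proof (rule ennreal_sum_ge_card)
  interpret Q: cring "Qp p" by (rule Qp_cring[OF p])
  fix b assume b: "b \<in> B"
  then have "x \<ominus>\<^bsub>Qp p\<^esub> b \<in> carrier (Qp p)" using assms(1,2) digits_closed by blast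
  then show "1 \<le> ennreal (w (x \<ominus>\<^bsub>Qp p\<^esub> b))"
    using w_ge assms(3)[OF b] by (simp add: ennreal_ge_1)
qed

text \<open>By \<open>digits_cong_eq\<close> at most one element of \<open>B\<close> is congruent to
  \<open>x\<close>; removing it leaves the situation of \<open>penalty_ge_card\<close>.\<close>

lemma penalty_ge:
  assumes B: "B \<subseteq> digits p" and x: "x \<in> carrier (Qp p)"
  shows "of_nat (card B - 1) \<le> (\<Sum>b\<in>B. ennreal (w (x \<ominus>\<^bsub>Qp p\<^esub> b)))"
proof (cases "\<exists>a\<in>B. x \<ominus>\<^bsub>Qp p\<^esub> a \<in> pZp p")
  case True
  then obtain a where a: "a \<in> B" "x \<ominus>\<^bsub>Qp p\<^esub> a \<in> pZp p" by blast
  have fin: "finite B" using finite_subset[OF B finite_digits] .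
  have "of_nat (card (B - {a})) \<le> (\<Sum>b\<in>B - {a}. ennreal (w (x \<ominus>\<^bsub>Qp p\<^esub> b)))"
    using B x a digits_cong_eq[OF p _ _ x] by (intro penalty_ge_card) blast+
  also have "\<dots> \<le> (\<Sum>b\<in>B. ennreal (w (x \<ominus>\<^bsub>Qp p\<^esub> b)))"
    using fin by (intro sum_mono2) auto
  finally show ?thesis using fin a(1) by simp
next
  case False
  have "(of_nat (card B - 1) :: ennreal) \<le> of_nat (card B)" by simp
  also have "\<dots> \<le> (\<Sum>b\<in>B. ennreal (w (x \<ominus>\<^bsub>Qp p\<^esub> b)))"
    using False B x by (intro penalty_ge_card) auto
  finally show ?thesis .
qed

end

text \<open>The summand at \<open>x\<close> itself vanishes and every other one is exactly
  1.\<close>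

lemma penalty_digit:
  assumes p: "prime p" and B: "B \<subseteq> digits p" and x: "x \<in> B"
    and w0: "w \<zero>\<^bsub>Qp p\<^esub> = 0"
    and w1: "\<And>a b. a \<in> digits p \<Longrightarrow> b \<in> digits p \<Longrightarrow> a \<noteq> b \<Longrightarrow> w (a \<ominus>\<^bsub>Qp p\<^esub> b) = 1"
  shows "(\<Sum>b\<in>B. ennreal (w (x \<ominus>\<^bsub>Qp p\<^esub> b))) = of_nat (card B - 1)"
proof -
  interpret Q: cring "Qp p" by (rule Qp_cring[OF p])
  have fin: "finite B" using finite_subset[OF B finite_digits] .
  have "x \<ominus>\<^bsub>Qp p\<^esub> x = \<zero>\<^bsub>Qp p\<^esub>"
    using B x digits_closed by (simp add: a_minus_def Q.r_neg subset_iff)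
  then have "(\<Sum>b\<in>B. ennreal (w (x \<ominus>\<^bsub>Qp p\<^esub> b))) = (\<Sum>b\<in>B - {x}. ennreal (w (x \<ominus>\<^bsub>Qp p\<^esub> b)))"
    using fin x w0 by (simp add: sum.remove)
  also have "\<dots> = (\<Sum>b\<in>B - {x}. 1)"
    using B x w1 by (intro sum.cong) (auto simp: subset_iff)
  finally show ?thesis using fin x by simp
qed

section \<open>Thickenings of boxes\<close>

text \<open>The box component \<open>b\<close> of a point of the thickening fits the description in
  \<open>vec_mod\<close>, and \<open>digits_cong_eq\<close> makes it unique, so reduction returns
  \<open>b\<close>.\<close>

lemma thicken_box_cases:
  assumes p: "prime p" and B: "\<forall>d<n. B d \<subseteq> digits p"
    and c: "c \<in> thicken p n (\<Pi>\<^sub>E d\<in>{..<n}. B d)"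
  shows "c \<in> Qp_vec p n" "vec_mod p n c \<in> (\<Pi>\<^sub>E d\<in>{..<n}. B d)"
proof -
  interpret Q: cring "Qp p" by (rule Qp_cring[OF p])
  obtain b z where b: "b \<in> (\<Pi>\<^sub>E d\<in>{..<n}. B d)" and z: "z \<in> {..<n} \<rightarrow>\<^sub>E pZp p"
    and c: "c = (\<lambda>d\<in>{..<n}. b d \<oplus>\<^bsub>Qp p\<^esub> z d)" using c by (auto simp: thicken_def)
  have bd: "b d \<in> digits p" and zd: "z d \<in> pZp p" if "d < n" for d
    using b z B that by (auto simp: PiE_iff)
  have cl: "b d \<in> carrier (Qp p)" "z d \<in> carrier (Qp p)" "c d \<in> carrier (Qp p)" if "d < n" for d
    using bd[OF that] zd[OF that] pZp_closed[OF p] digits_closed that by (auto simp: c)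
  show "c \<in> Qp_vec p n" using cl by (auto simp: Qp_vec_def c)
  have cong: "c d \<ominus>\<^bsub>Qp p\<^esub> b d \<in> pZp p" if "d < n" for d
  proof -
    have "(b d \<oplus>\<^bsub>Qp p\<^esub> z d) \<ominus>\<^bsub>Qp p\<^esub> b d = z d" using cl(1,2)[OF that] by algebra
    then show ?thesis using zd that by (simp add: c)
  qed
  have "vec_mod p n c = b"
    unfolding vec_mod_def
  proof (rule the_equality)
    show "b \<in> {..<n} \<rightarrow>\<^sub>E digits p \<and> (\<forall>d<n. c d \<ominus>\<^bsub>Qp p\<^esub> b d \<in> pZp p)"
      using b bd cong by (auto simp: PiE_iff)
    fix y assume y: "y \<in> {..<n} \<rightarrow>\<^sub>E digits p \<and> (\<forall>d<n. c d \<ominus>\<^bsub>Qp p\<^esub> y d \<in> pZp p)"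
    \<comment> \<open>Coordinates below \<open>n\<close> agree by uniqueness of congruent digits;
      all others are \<open>undefined\<close> on both sides.\<close>
    show "y = b"
    proof (rule PiE_ext)
      show "y \<in> {..<n} \<rightarrow>\<^sub>E digits p" "b \<in> (\<Pi>\<^sub>E d\<in>{..<n}. digits p)"
        using y b bd by (auto simp: PiE_iff)
      show "y d = b d" if "d \<in> {..<n}" for d
        using digits_cong_eq[OF p, of "y d" "b d" "c d"] y bd cong cl that by (auto simp: PiE_iff)
    qed
  qed
  then show "vec_mod p n c \<in> (\<Pi>\<^sub>E d\<in>{..<n}. B d)" using b by simp
qed

text \<open>A congruent digit is chosen in each coordinate, and the difference supplies the
  \<open>pZp\<close> component.\<close>

lemma mem_thicken_box:
  assumes p: "prime p" and B: "\<forall>d<n. B d \<subseteq> digits p"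
    and c: "c \<in> Qp_vec p n" and ex: "\<And>d. d < n \<Longrightarrow> \<exists>b\<in>B d. c d \<ominus>\<^bsub>Qp p\<^esub> b \<in> pZp p"
  shows "c \<in> thicken p n (\<Pi>\<^sub>E d\<in>{..<n}. B d)"
proof -
  interpret Q: cring "Qp p" by (rule Qp_cring[OF p])
  obtain b where b: "\<And>d. d < n \<Longrightarrow> b d \<in> B d \<and> c d \<ominus>\<^bsub>Qp p\<^esub> b d \<in> pZp p"
    using ex by metis
  have "b d \<oplus>\<^bsub>Qp p\<^esub> (c d \<ominus>\<^bsub>Qp p\<^esub> b d) = c d" if d: "d < n" for d
  proof -
    have "b d \<in> carrier (Qp p)" "c d \<in> carrier (Qp p)"
      using b[OF d] B c d digits_closed by (auto simp: Qp_vec_def PiE_iff)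
    then show ?thesis by (simp add: a_minus_def Q.a_lcomm[of _ "c d"] Q.r_neg)
  qed
  \<comment> \<open>Both components are restricted to \<open>{..<n}\<close> so that they lie in the
    extensional products used by \<open>thicken\<close>.\<close>
  then have "c = (\<lambda>d\<in>{..<n}. restrict b {..<n} d \<oplus>\<^bsub>Qp p\<^esub>
      (\<lambda>d\<in>{..<n}. c d \<ominus>\<^bsub>Qp p\<^esub> b d) d)"
    using c by (auto simp: Qp_vec_def PiE_iff extensional_def restrict_def fun_eq_iff)
  moreover have "restrict b {..<n} \<in> (\<Pi>\<^sub>E d\<in>{..<n}. B d)"
    "(\<lambda>d\<in>{..<n}. c d \<ominus>\<^bsub>Qp p\<^esub> b d) \<in> {..<n} \<rightarrow>\<^sub>E pZp p" using b by auto
  ultimately show ?thesis unfolding thicken_def by blast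
qed

text \<open>Concentration allows only the values 0 and 1 at the reduced point, and the value 1
  forces at least 1 at \<open>c\<close>; so the comparison holds termwise.\<close>

lemma concentrated_vec_mod_le:
  assumes "concentrated p ls C" "c \<in> thicken p (seq_dim ls) C"
  shows "objective (seq_sum ls) (vec_mod p (seq_dim ls) c) \<le> objective (seq_sum ls) c"
proof -
  have "objective (ls ! i) (vec_mod p (seq_dim ls) c) \<le> objective (ls ! i) c"
    if "i < length ls" for i
  proof (cases "objective (ls ! i) (vec_mod p (seq_dim ls) c) = 0")
    case False
    then have "objective (ls ! i) (vec_mod p (seq_dim ls) c) = 1" "1 \<le> objective (ls ! i) c"
      using assms that unfolding concentrated_def by (meson zero_less_iff_neq_zero)+
    then show ?thesis by simp
  qed simp
  then show ?thesis by (auto simp: seq_sum_def intro!: sum_mono)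
qed

theorem theorem4p2:
  fixes p n M :: nat
    and r :: real
    and ls :: "padic_opt list"
    and l :: padic_opt
    and B :: "nat \<Rightarrow> padic set"
    and C :: "padic_vec set"
    and w :: "padic \<Rightarrow> real"
  assumes "prime p"
    and "0 < r" and "r < 1"
    and "\<forall>i<length ls. \<forall>j<length ls. opt_dim (ls ! i) = opt_dim (ls ! j)"
    and "n = seq_dim ls"
    and "\<forall>d<n. B d \<noteq> {} \<and> B d \<subseteq> digits p"
    and "C = (\<Pi>\<^sub>E d\<in>{..<n}. B d)"
    and "(SUP c\<in>C. objective (seq_sum ls) c) < of_nat M"
    and "concentrated p ls C"
    and "w = padic_abs p r \<or> w = (\<lambda>x. if x \<in> pZp p then 0 else 1)"
    and "l = Padic_Opt n (\<lambda>c. objective (seq_sum ls) c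
           + of_nat M * (\<Sum>d<n. \<Sum>b\<in>B d. ennreal (w (c d \<ominus>\<^bsub>Qp p\<^esub> b))))"
  shows "one_reducible p C l \<and>
    (\<forall>c\<in>C. optimal p l c \<longleftrightarrow> optimal_on (seq_sum ls) C c)"
proof -
  note p = assms(1) and r = assms(2,3) and n = assms(5) and C = assms(7)
  have B: "\<forall>d<n. B d \<subseteq> digits p" and Bne: "\<forall>d<n. B d \<noteq> {}" using assms(6) by auto
  interpret Q: cring "Qp p" by (rule Qp_cring[OF p])
  \<comment> \<open>For every normalisation \<open>pZp\<close> is the open unit ball, so the
    absolute value is at least 1 off it; the indicator equals 1 there.\<close>
  have w_ge: "1 \<le> w x" if "x \<in> carrier (Qp p)" "x \<notin> pZp p" for x
    using assms(10) that pZp_iff[OF p r, of x] by auto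
  have zero: "padic_abs p r \<zero>\<^bsub>Qp p\<^esub> = 0"
    by (simp add: zero_Qp[OF p] padic_abs_of_rat[OF p r])
  then have w0: "w \<zero>\<^bsub>Qp p\<^esub> = 0" using assms(10) pZp_iff[OF p r, of "\<zero>\<^bsub>Qp p\<^esub>"] by auto
  have w1: "w (a \<ominus>\<^bsub>Qp p\<^esub> b) = 1" if "a \<in> digits p" "b \<in> digits p" "a \<noteq> b" for a b
    using assms(10) padic_abs_digit_diff[OF p r that] pZp_iff[OF p r, of "a \<ominus>\<^bsub>Qp p\<^esub> b"] by auto

  define obj0 where "obj0 = objective (seq_sum ls)"
  define W where "W c = (\<Sum>d<n. \<Sum>b\<in>B d. ennreal (w (c d \<ominus>\<^bsub>Qp p\<^esub> b)))" for c
  \<comment> \<open>\<open>k\<close> is the least value of \<open>W\<close> on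
    \<open>Qp_vec p n\<close>, attained throughout \<open>C\<close>; \<open>base\<close> is the
    resulting constant offset between \<open>objective l\<close> and \<open>obj0\<close> on
    \<open>C\<close>.\<close>
  define k where "k = (\<Sum>d<n. card (B d) - 1)"
  define base :: ennreal where "base = of_nat M * of_nat k"
  \<comment> \<open>Finiteness is what permits cancelling \<open>base\<close> in
    \<open>ennreal\<close>.\<close>
  have base_fin: "base < Orderings.top" by (simp add: base_def ennreal_mult_less_top of_nat_less_top)
  have dim: "opt_dim l = n" and obj: "objective l c = obj0 c + of_nat M * W c" for c
    by (simp_all add: assms(11) obj0_def W_def)
  have C_sub: "C \<subseteq> Qp_vec p n"
    using B digits_closed by (fastforce simp: C Qp_vec_def PiE_iff)
  \<comment> \<open>\<open>c0\<close> serves as the competitor that excludes optima outside the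
    thickening.\<close>
  obtain c0 where c0: "c0 \<in> C" using Bne C PiE_eq_empty_iff[of "{..<n}" B] by blast
  have obj0_less: "obj0 c < of_nat M" if "c \<in> C" for c
    using SUP_upper[OF that, of obj0] assms(8) by (simp add: obj0_def)

  have obj_C: "objective l c = obj0 c + base" if "c \<in> C" for c
  proof -
    have "W c = (\<Sum>d<n. of_nat (card (B d) - 1))"
      unfolding W_def using that B
      by (intro sum.cong penalty_digit[OF p _ _ w0 w1]) (auto simp: C PiE_iff)
    then show ?thesis by (simp add: obj base_def k_def)
  qed
  have W_ge: "of_nat k \<le> W c" if "c \<in> Qp_vec p n" for c
    unfolding W_def k_def of_nat_sum using that B
    by (intro sum_mono penalty_ge[OF p w_ge]) (auto simp: Qp_vec_def PiE_iff)
  have obj_ge: "obj0 c + base \<le> objective l c" if "c \<in> Qp_vec p n" for c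
    unfolding obj base_def by (intro add_left_mono mult_left_mono W_ge that) simp

  \<comment> \<open>Some coordinate \<open>e\<close> is congruent to no element of
    \<open>B e\<close>, which raises the penalty count to at least \<open>k + 1\<close>. The extra
    \<open>M\<close> exceeds every value of \<open>obj0\<close> on \<open>C\<close>.\<close>
  have outside: "objective l c' < objective l c"
    if c: "c \<in> Qp_vec p n" "c \<notin> thicken p n C" and c': "c' \<in> C" for c c'
  proof -
    obtain e where e: "e < n" "\<And>b. b \<in> B e \<Longrightarrow> c e \<ominus>\<^bsub>Qp p\<^esub> b \<notin> pZp p"
      using mem_thicken_box[OF p B c(1)] c(2) C by blast
    \<comment> \<open>Positivity prevents truncation in \<open>card (B e) - 1\<close>, so replacing
      that term by \<open>card (B e)\<close> adds exactly 1 to \<open>k\<close>.\<close>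
    have "card (B e) > 0"
      using e(1) B Bne finite_subset[OF _ finite_digits, of "B e" p] by (simp add: card_gt_0_iff)
    then have "Suc k = (\<Sum>d\<in>{..<n} - {e}. card (B d) - 1) + card (B e)"
      unfolding k_def using e(1) by (simp add: sum.remove[of "{..<n}" e])
    then have "of_nat (Suc k) =
        (\<Sum>d\<in>{..<n} - {e}. of_nat (card (B d) - 1)) + (of_nat (card (B e)) :: ennreal)"
      by (simp only: of_nat_add of_nat_sum)
    also have "\<dots> \<le> (\<Sum>d\<in>{..<n} - {e}. \<Sum>b\<in>B d. ennreal (w (c d \<ominus>\<^bsub>Qp p\<^esub> b)))
        + (\<Sum>b\<in>B e. ennreal (w (c e \<ominus>\<^bsub>Qp p\<^esub> b)))"
      using c(1) B e
      by (intro add_mono sum_mono penalty_ge[OF p w_ge] penalty_ge_card[OF p w_ge])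
        (auto simp: Qp_vec_def PiE_iff)
    also have "\<dots> = W c" unfolding W_def using e(1) by (simp add: sum.remove[of "{..<n}" e] add.commute)
    finally have "of_nat M * of_nat (Suc k) \<le> of_nat M * W c" by (intro mult_left_mono) auto
    then have "of_nat M + base \<le> objective l c"
      unfolding obj base_def by (simp add: distrib_left add_increasing)
    moreover have "obj0 c' + base < of_nat M + base"
      using obj0_less[OF c'] base_fin by (simp add: ennreal_add_left_cancel_less add.commute[of _ base])
    ultimately show ?thesis unfolding obj_C[OF c'] by (rule less_le_trans[rotated])
  qed
  have inside: "vec_mod p n c \<in> C" "objective l (vec_mod p n c) \<le> objective l c"
    if c: "c \<in> thicken p n C" for c
  proof -
    show C': "vec_mod p n c \<in> C" using thicken_box_cases(2)[OF p B] c C by blast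
    \<comment> \<open>Reduction does not raise \<open>obj0\<close>, and the penalty after reduction
      is the least possible.\<close>
    have "obj0 (vec_mod p n c) + base \<le> obj0 c + base"
      using concentrated_vec_mod_le[OF assms(9)] c by (auto simp: obj0_def n intro!: add_right_mono)
    also have "\<dots> \<le> objective l c" using thicken_box_cases(1)[OF p B] c C by (intro obj_ge) blast
    finally show "objective l (vec_mod p n c) \<le> objective l c" unfolding obj_C[OF C'] .
  qed
  \<comment> \<open>Inside the thickening the competitor is the reduction of \<open>c\<close>,
    outside it is \<open>c0\<close>; hence a minimiser over \<open>C\<close> is a global
    one.\<close>
  have dominated: "\<exists>c'\<in>C. objective l c' \<le> objective l c" if "c \<in> Qp_vec p n" for c
    using inside[of c] outside[OF that _ c0] c0 by (meson less_imp_le)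

  have opt_C: "optimal p l c \<longleftrightarrow> optimal_on l C c" if "c \<in> C" for c
    using that C_sub dominated unfolding optimal_def optimal_on_def dim by (meson order_trans subsetD)
  have reduce: "c \<in> thicken p n C \<and> optimal_on l C (vec_mod p n c)" if c: "optimal p l c" for c
  proof
    have le: "objective l c \<le> objective l c'" if "c' \<in> C" for c'
      using c C_sub that unfolding optimal_def optimal_on_def dim by blast
    have cQ: "c \<in> Qp_vec p n" using c unfolding optimal_def optimal_on_def dim by blast
    \<comment> \<open>Otherwise \<open>c0\<close> would be strictly better than the optimal
      \<open>c\<close>.\<close>
    show t: "c \<in> thicken p n C" using outside[OF cQ _ c0] le[OF c0] by (meson leD)
    show "optimal_on l C (vec_mod p n c)"
      unfolding optimal_on_def using inside[OF t] le by (meson order_trans)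
  qed
  have "one_reducible p C l"
    unfolding one_reducible_def dim using opt_C reduce by (meson optimal_on_def)
  \<comment> \<open>On \<open>C\<close> the two objectives differ by the finite constant
    \<open>base\<close>, which cancels from every comparison.\<close>
  moreover have "optimal_on l C c \<longleftrightarrow> optimal_on (seq_sum ls) C c" for c
    unfolding optimal_on_def using base_fin
    by (auto simp: obj_C obj0_def[symmetric] ennreal_add_left_cancel_le add.commute[of _ base])
  ultimately show ?thesis using opt_C by simp
qed

end
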